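(* Let $P\subset\mathbb{R}^2$ be an integral convex polygon contained in $\Box_{q-1}$ after translation, and let $P_1,\dots,P_\ell$ be lattice polygons with $\sum_{i=1}^\ell P_i \subseteq P$ (Minkowski sum). Let $m_i$ be the maximum number of zeroes in $(\mathbb{F}_q^{*})^2$ of a nonzero section of the line bundle corresponding to $P_i$ on the toric surface $X$ of $P$, and assume that there exist nonzero sections $s_i$ of these line bundles ($1\le i\le\ell$), with $s_i$ having exactly $m_i$ zeroes in $(\mathbb{F}_q^{*})^2$, such that the sets of zeroes of the $s_i$ in $(\mathbb{F}_q^{*})^2$ are pairwise disjoint. Then $$d(C_P(\mathbb{F}_q)) \le \sum_{i=1}^\ell d(C_{P_i}(\mathbb{F}_q)) - (\ell-1)(q-1)^2 .$$
   Context: $\Box_{q-1}$ denotes the square $[0,q-2]\times[0,q-2]$ and $\mathbb{F}_q$ is a finite field. An integral convex polygon (lattice polygon) is the convex hull of a finite set of points of $\mathbb{Z}^2$ (line segments allowed). The Minkowski sum is $P+Q=\{x+y : x\in P, y\in Q\}$. The sections (over $\mathbb{F}_q$) of the line bundle corresponding to a lattice polygon $Q$ are identified with the $\mathbb{F}_q$-linear combinations of the monomials $x^{a}y^{b}$ with $(a,b)\in Q\cap\mathbb{Z}^2$; the zeroes of such a section in $(\mathbb{F}_q^{*})^2$ are the points of $(\mathbb{F}_q^{*})^2$ at which this Laurent polynomial vanishes. Toric code: let $\xi$ be a primitive element of $\mathbb{F}_q$, and for $0\le i,j\le q-2$ let $P_{ij}=(\xi^i,\xi^j)\in(\mathbb{F}_q^{*})^2$.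 For a lattice point $m=(m_1,m_2)$ put $e(m)(P_{ij})=(\xi^i)^{m_1}(\xi^j)^{m_2}$. For a lattice polygon $Q$ contained in $\Box_{q-1}$ after translation by an integer vector, $C_Q(\mathbb{F}_q)$ is the linear code over $\mathbb{F}_q$ of block length $(q-1)^2$ spanned by the vectors $(e(m)(P_{ij}))_{0\le i,j\le q-2}$, $m\in Q\cap\mathbb{Z}^2$. $d(C)$ denotes the minimum distance of the linear code $C$. *)

theory Defs
  imports
    "HOL-Analysis.Analysis"
    "HOL-Library.Set_Algebras"
    "HOL-Library.Function_Algebras"
    "HOL-Library.Disjoint_Sets"
    "HOL-Library.Poly_Mapping"
begin

definition lattice_point :: "int \<times> int \<Rightarrow> real \<times> real" where
  "lattice_point m = (real_of_int (fst m), real_of_int (snd m))"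

(* Points and line segments count as polygons; the empty set does not. *)
definition lattice_polygon :: "(real \<times> real) set \<Rightarrow> bool" where
  "lattice_polygon Q \<longleftrightarrow>
     (\<exists>S. finite S \<and> S \<noteq> {} \<and> Q = convex hull (lattice_point ` S))"

(* square n is the real square with corners (0,0) and (n-1,n-1),
   so the square [0,q-2] x [0,q-2] is square (q-1). *)
definition square :: "nat \<Rightarrow> (real \<times> real) set" where
  "square n = {0..real n - 1} \<times> {0..real n - 1}"

definition fits_in_square :: "nat \<Rightarrow> (real \<times> real) set \<Rightarrow> bool" where
  "fits_in_square n Q \<longleftrightarrow> (\<exists>t. (\<lambda>x. x + lattice_point t) ` Q \<subseteq> square n)"


(* The Laurent polynomial ring in x, y over 'a is the type (int \<times> int) \<Rightarrow>\<^sub>0 'a, where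
   (a, b) is the exponent of x^a y^b. *)
definition sections :: "(real \<times> real) set \<Rightarrow> ((int \<times> int) \<Rightarrow>\<^sub>0 'a::field) set" where
  "sections Q = {s. lattice_point ` Poly_Mapping.keys s \<subseteq> Q}"

definition laurent_eval :: "((int \<times> int) \<Rightarrow>\<^sub>0 'a::field) \<Rightarrow> 'a \<times> 'a \<Rightarrow> 'a" where
  "laurent_eval s p =
     (\<Sum>m\<in>Poly_Mapping.keys s. Poly_Mapping.lookup s m * fst p powi fst m * snd p powi snd m)"

definition torus_zeros :: "((int \<times> int) \<Rightarrow>\<^sub>0 'a::field) \<Rightarrow> ('a \<times> 'a) set" where
  "torus_zeros s = {(x, y). x \<noteq> 0 \<and> y \<noteq> 0 \<and> laurent_eval s (x, y) = 0}"


definition primitive_element :: "'a::field \<Rightarrow> bool" where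
  "primitive_element \<xi> \<longleftrightarrow> \<xi> \<noteq> 0 \<and> (\<forall>x. x \<noteq> 0 \<longrightarrow> (\<exists>k::nat. x = \<xi> ^ k))"

(* Words whose coordinates are indexed by a finite set I are functions that vanish
   outside I; the block length is card I. *)
definition hamming_distance :: "'i set \<Rightarrow> ('i \<Rightarrow> 'a) \<Rightarrow> ('i \<Rightarrow> 'a) \<Rightarrow> nat" where
  "hamming_distance I u v = card {k \<in> I. u k \<noteq> v k}"

definition minimum_distance :: "'i set \<Rightarrow> ('i \<Rightarrow> 'a) set \<Rightarrow> nat" where
  "minimum_distance I C = Min {hamming_distance I u v | u v. u \<in> C \<and> v \<in> C \<and> u \<noteq> v}"

definition linear_span :: "('i \<Rightarrow> 'a::field) set \<Rightarrow> ('i \<Rightarrow> 'a) set" where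
  "linear_span = module.span (\<lambda>c v k. c * v k)"

lemma module_words: "module (\<lambda>c v k. c * v k :: 'a::field)"
  by unfold_locales (auto simp: fun_eq_iff algebra_simps)

definition toric_index :: "nat \<Rightarrow> (nat \<times> nat) set" where
  "toric_index q = {0..q - 2} \<times> {0..q - 2}"

(* The word e(m), with coordinate e(m)(P_ij) at (i,j). *)
definition toric_word :: "'a::{finite,field} \<Rightarrow> int \<times> int \<Rightarrow> nat \<times> nat \<Rightarrow> 'a" where
  "toric_word \<xi> m = (\<lambda>(i, j). if (i, j) \<in> toric_index CARD('a)
     then (\<xi> ^ i) powi fst m * (\<xi> ^ j) powi snd m else 0)"

definition toric_code :: "'a::{finite,field} \<Rightarrow> (real \<times> real) set \<Rightarrow> (nat \<times> nat \<Rightarrow> 'a) set" where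
  "toric_code \<xi> Q = linear_span (toric_word \<xi> ` {m. lattice_point m \<in> Q})"

definition toric_distance :: "'a::{finite,field} \<Rightarrow> (real \<times> real) set \<Rightarrow> nat" where
  "toric_distance \<xi> Q = minimum_distance (toric_index CARD('a)) (toric_code \<xi> Q)"

end

theory Submission
  imports Defs
begin

text \<open>
  Write \<open>N = (q - 1)\<^sup>2\<close> for the number of points of the torus. The code of a polygon consists of
  the value vectors on the torus of its sections, and two words differ in \<open>N\<close> minus
  the number of zeroes of the difference of their sections
  (\<open>toric_code_eq_section_words\<close>, \<open>hamming_distance_plus_torus_zeros\<close>). Thus every section of
  \<open>P\<close> that does not vanish on the whole torus gives an upper bound for the minimum distance
  of the code of \<open>P\<close>, and the maximal number of zeroes \<open>m i\<close> gives the lower bound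
  \<open>N - m i\<close> for that of the code of \<open>Q i\<close>.

  The product \<open>s\<close> of the given sections is a section of the Minkowski sum, hence of \<open>P\<close>. Its zero
  set is the disjoint union of theirs, so that \<open>s\<close> has exactly \<open>\<Sum>i=1..l. m i\<close> zeroes and, with \<open>d\<close>
  for the minimum distance of the code of a polygon,
  \[ d(P) \le N - \sum_i m_i = \sum_{i=1}^{l} (N - m_i) - (l-1) N
       \le \sum_{i=1}^{l} d(Q_i) - (l-1) N . \]

  The first inequality needs \<open>s\<close> to be nonzero at some point of the torus, which takes two steps. The
  ring of Laurent polynomials has no zero divisors (\<open>laurent_mult_nonzero\<close>), so \<open>s \<noteq> 0\<close>. And
  a nonzero section of a polygon that fits in the square cannot vanish on the whole torus
  (\<open>nonzero_section_nonvanishing\<close>): the exponents that occur are pairwise incongruent modulo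
  \<open>q - 1\<close>, so that distinct monomials are distinct characters of the torus, and the orthogonality
  of characters recovers each coefficient from the values
  (\<open>laurent_coefficient_from_torus_values\<close>).
\<close>

section \<open>The torus of a finite field\<close>

lemma card_units: "card (- {0::'a::{finite,field}}) = CARD('a) - 1"
  by (simp add: Compl_eq_Diff_UNIV card_Diff_singleton)

text \<open>
  Since \<open>\<xi> ^ (q - 1) = 1\<close>, the exponents of all powers of \<open>\<xi>\<close> can be reduced to the range
  \<open>{0..q - 2}\<close>. These \<open>q - 1\<close> powers must cover the \<open>q - 1\<close> units, so they are distinct.
\<close>

lemma primitive_element_bij_betw:
  fixes \<xi> :: "'a::{finite,field}"
  assumes "primitive_element \<xi>"
  shows "bij_betw (\<lambda>i. \<xi> ^ i) {0..CARD('a) - 2} (- {0})"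
proof -
  let ?n = "CARD('a) - 1"
  have \<xi>0: "\<xi> \<noteq> 0" and pow: "\<And>x. x \<noteq> 0 \<Longrightarrow> \<exists>k. x = \<xi> ^ k"
    using assms by (auto simp: primitive_element_def)
  have "card {0, 1::'a} \<le> CARD('a)"
    by (rule card_mono) auto
  then have q2: "CARD('a) \<ge> 2"
    by simp
  \<comment> \<open>Multiplication by \<open>\<xi>\<close> permutes the units, so the product of all units is
    unchanged by the factor \<open>\<xi> ^ (q - 1)\<close>.\<close>
  have "(\<Prod>x\<in>-{0}. x) = (\<Prod>x\<in>-{0}. \<xi> * x)"
    by (rule prod.reindex_bij_witness[of _ "\<lambda>x. \<xi> * x" "\<lambda>x. x / \<xi>"]) (use \<xi>0 in auto)
  also have "\<dots> = \<xi> ^ ?n * (\<Prod>x\<in>-{0}. x)"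
    by (simp add: prod.distrib card_units)
  finally have \<xi>n: "\<xi> ^ ?n = 1"
    by simp
  have image: "(\<lambda>i. \<xi> ^ i) ` {0..CARD('a) - 2} = - {0}"
  proof (intro equalityI subsetI)
    fix x :: 'a assume "x \<in> - {0}"
    then obtain k where "x = \<xi> ^ k"
      using pow by auto
    also have "\<xi> ^ k = \<xi> ^ (?n * (k div ?n) + k mod ?n)"
      by simp
    also have "\<dots> = \<xi> ^ (k mod ?n)"
      by (simp only: power_add power_mult \<xi>n) simp
    finally have "x = \<xi> ^ (k mod ?n)" .
    moreover have "k mod ?n < ?n"
      using q2 by simp
    then have "k mod ?n \<in> {0..CARD('a) - 2}"
      by auto
    ultimately show "x \<in> (\<lambda>i. \<xi> ^ i) ` {0..CARD('a) - 2}"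
      by blast
  qed (use \<xi>0 in auto)
  moreover have "inj_on (\<lambda>i. \<xi> ^ i) {0..CARD('a) - 2}"
    by (rule eq_card_imp_inj_on) (use image card_units[where 'a = 'a] q2 in auto)
  ultimately show ?thesis
    by (simp add: bij_betw_def)
qed

text \<open>
  Orthogonality of the characters of the unit group: the substitution \<open>x \<mapsto> \<xi> * x\<close> multiplies the
  sum by \<open>\<xi> powi k\<close>, which differs from \<open>1\<close> for \<open>0 < \<bar>k\<bar> < q - 1\<close>. For \<open>k = 0\<close> the sum is the
  image of \<open>q - 1\<close> in the field, where \<open>q\<close> itself is zero.
\<close>

lemma sum_units_powi:
  fixes \<xi> :: "'a::{finite,field}" and k :: int
  assumes \<xi>: "primitive_element \<xi>" and k: "\<bar>k\<bar> < int CARD('a) - 1"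
  shows "(\<Sum>x\<in>-{0::'a}. x powi k) = (if k = 0 then - 1 else 0)"
proof (cases "k = 0")
  case True
  \<comment> \<open>Translation by \<open>1\<close> permutes the field, so the sum of all elements changes by \<open>q\<close> and
    stays the same.\<close>
  have "(\<Sum>x\<in>UNIV. x) = (\<Sum>x\<in>UNIV. x + (1::'a))"
    by (rule sum.reindex_bij_witness[of _ "\<lambda>x. x + 1" "\<lambda>x. x - 1"]) auto
  then have "of_nat CARD('a) = (0::'a)"
    by (simp add: sum.distrib)
  then show ?thesis
    using True by (simp add: card_units of_nat_diff Suc_leI)
next
  case False
  have \<xi>0: "\<xi> \<noteq> 0"
    using \<xi> by (simp add: primitive_element_def)
  have \<xi>k: "\<xi> powi k \<noteq> 1"
  proof
    assume "\<xi> powi k = 1"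
    then have "\<xi> ^ nat \<bar>k\<bar> = \<xi> ^ 0"
      by (auto simp: power_int_def abs_if power_inverse split: if_splits)
    moreover have "nat \<bar>k\<bar> \<in> {0..CARD('a) - 2}"
      using k by auto
    ultimately have "nat \<bar>k\<bar> = 0"
      using primitive_element_bij_betw[OF \<xi>]
      by (metis atLeastAtMost_iff bij_betw_def inj_onD le0)
    then show False
      using False by simp
  qed
  have "(\<Sum>x\<in>-{0}. x powi k) = (\<Sum>x\<in>-{0}. (\<xi> * x) powi k)"
    by (rule sum.reindex_bij_witness[of _ "\<lambda>x. \<xi> * x" "\<lambda>x. x / \<xi>"]) (use \<xi>0 in auto)
  also have "\<dots> = \<xi> powi k * (\<Sum>x\<in>-{0::'a}. x powi k)"
    by (simp only: power_int_mult_distrib sum_distrib_left)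
  finally have "(\<Sum>x\<in>-{0}. x powi k) = \<xi> powi k * (\<Sum>x\<in>-{0::'a}. x powi k)" .
  with \<xi>k False show ?thesis
    by (simp add: mult_cancel_right1)
qed

section \<open>Evaluation of Laurent polynomials\<close>

lemma laurent_eval_superset:
  assumes "finite A" "Poly_Mapping.keys s \<subseteq> A"
  shows "laurent_eval s p =
    (\<Sum>m\<in>A. Poly_Mapping.lookup s m * fst p powi fst m * snd p powi snd m)"
  unfolding laurent_eval_def
  by (rule sum.mono_neutral_left) (use assms in \<open>auto simp: in_keys_iff\<close>)

lemma laurent_eval_zero [simp]: "laurent_eval 0 p = 0"
  by (simp add: laurent_eval_def)

lemma laurent_eval_single [simp]:
  "laurent_eval (Poly_Mapping.single m c) p = c * fst p powi fst m * snd p powi snd m"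
  by (subst laurent_eval_superset[of "{m}"]) auto

lemma laurent_eval_add: "laurent_eval (s + t) p = laurent_eval s p + laurent_eval t p"
proof -
  let ?A = "Poly_Mapping.keys s \<union> Poly_Mapping.keys t"
  have "Poly_Mapping.keys (s + t) \<subseteq> ?A"
    by (rule keys_add)
  then show ?thesis
    by (subst (1 2 3) laurent_eval_superset[of ?A])
      (auto simp: lookup_add algebra_simps sum.distrib)
qed

lemma laurent_eval_diff: "laurent_eval (s - t) p = laurent_eval s p - laurent_eval t p"
  using laurent_eval_add[of "s - t" t p] by simp

lemma laurent_eval_sum: "laurent_eval (\<Sum>i\<in>I. s i) p = (\<Sum>i\<in>I. laurent_eval (s i) p)"
  by (induction I rule: infinite_finite_induct) (auto simp: laurent_eval_add)

lemma poly_mapping_sum_single: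
  "s = (\<Sum>m\<in>Poly_Mapping.keys s. Poly_Mapping.single m (Poly_Mapping.lookup s m))"
  by (rule poly_mapping_eqI) (auto simp: lookup_sum lookup_single when_def in_keys_iff)

lemma poly_mapping_mult_expand:
  fixes s t :: "'m::monoid_add \<Rightarrow>\<^sub>0 'a::semiring_0"
  shows "s * t = (\<Sum>a\<in>Poly_Mapping.keys s. \<Sum>b\<in>Poly_Mapping.keys t.
    Poly_Mapping.single (a + b) (Poly_Mapping.lookup s a * Poly_Mapping.lookup t b))"
proof -
  have "s * t = (\<Sum>a\<in>Poly_Mapping.keys s. Poly_Mapping.single a (Poly_Mapping.lookup s a)) *
    (\<Sum>b\<in>Poly_Mapping.keys t. Poly_Mapping.single b (Poly_Mapping.lookup t b))"
    by (simp flip: poly_mapping_sum_single)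
  then show ?thesis
    by (simp add: sum_product mult_single)
qed

lemma laurent_eval_mult:
  assumes "fst p \<noteq> 0" "snd p \<noteq> 0"
  shows "laurent_eval (s * t) p = laurent_eval s p * laurent_eval t p"
proof -
  have "laurent_eval (s * t) p = (\<Sum>a\<in>Poly_Mapping.keys s. \<Sum>b\<in>Poly_Mapping.keys t.
      (Poly_Mapping.lookup s a * fst p powi fst a * snd p powi snd a) *
      (Poly_Mapping.lookup t b * fst p powi fst b * snd p powi snd b))"
    by (subst poly_mapping_mult_expand)
      (simp add: laurent_eval_sum power_int_add assms algebra_simps)
  then show ?thesis
    by (simp add: laurent_eval_def sum_product)
qed

lemma torus_zeros_mult: "torus_zeros (s * t) = torus_zeros s \<union> torus_zeros t"
  by (auto simp: torus_zeros_def laurent_eval_mult)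

lemma torus_zeros_prod:
  assumes "finite I"
  shows "torus_zeros (\<Prod>i\<in>I. s i) = (\<Union>i\<in>I. torus_zeros (s i))"
  using assms
proof (induction I)
  case empty
  show ?case
    by (simp add: torus_zeros_def flip: single_one)
qed (simp add: torus_zeros_mult)

section \<open>Sections and Minkowski sums\<close>

text \<open>
  The order on pairs that comes with the real plane is the componentwise one, which need not have
  a maximum on a finite set. The lexicographic order is therefore spelled out here.
\<close>

lemma lexicographic_maximum_int_pair:
  fixes A :: "(int \<times> int) set"
  assumes "finite A" "A \<noteq> {}"
  obtains a where "a \<in> A"
    "\<And>a'. a' \<in> A \<Longrightarrow> fst a' < fst a \<or> fst a' = fst a \<and> snd a' \<le> snd a"
proof -
  define x where "x = Max (fst ` A)"
  define y where "y = Max (snd ` {a \<in> A. fst a = x})"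
  have "x \<in> fst ` A"
    unfolding x_def using assms by (intro Max_in) auto
  then have "y \<in> snd ` {a \<in> A. fst a = x}"
    unfolding y_def using assms by (intro Max_in) auto
  then have "(x, y) \<in> A"
    by auto
  moreover have "fst a' < x \<or> fst a' = x \<and> snd a' \<le> y" if "a' \<in> A" for a'
  proof -
    have "fst a' \<le> x"
      unfolding x_def using assms that by simp
    moreover have "snd a' \<le> y" if "fst a' = x"
      unfolding y_def using assms \<open>a' \<in> A\<close> that by (intro Max_ge) auto
    ultimately show ?thesis
      by linarith
  qed
  ultimately show thesis
    using that[of "(x, y)"] by auto
qed

text \<open>
  The lexicographic order is compatible with addition, so the sum of the two leading exponents
  arises in only one way as a sum of exponents of the factors. Its coefficient in the product is
  the product of the two leading coefficients.
\<close>

lemma laurent_mult_nonzero: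
  fixes s t :: "(int \<times> int) \<Rightarrow>\<^sub>0 'a::field"
  assumes "s \<noteq> 0" "t \<noteq> 0"
  shows "s * t \<noteq> 0"
proof -
  obtain a where a: "a \<in> Poly_Mapping.keys s"
    "\<And>a'. a' \<in> Poly_Mapping.keys s \<Longrightarrow> fst a' < fst a \<or> fst a' = fst a \<and> snd a' \<le> snd a"
    using lexicographic_maximum_int_pair[of "Poly_Mapping.keys s"] assms by auto
  obtain b where b: "b \<in> Poly_Mapping.keys t"
    "\<And>b'. b' \<in> Poly_Mapping.keys t \<Longrightarrow> fst b' < fst b \<or> fst b' = fst b \<and> snd b' \<le> snd b"
    using lexicographic_maximum_int_pair[of "Poly_Mapping.keys t"] assms by auto
  have unique: "a' + b' = a + b \<longleftrightarrow> a' = a \<and> b' = b"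
    if "a' \<in> Poly_Mapping.keys s" "b' \<in> Poly_Mapping.keys t" for a' b'
    using a(2)[OF that(1)] b(2)[OF that(2)] by (auto simp: prod_eq_iff)
  have "Poly_Mapping.lookup (s * t) (a + b) =
    (\<Sum>a'\<in>Poly_Mapping.keys s. \<Sum>b'\<in>Poly_Mapping.keys t.
      if b' = b then if a' = a then Poly_Mapping.lookup s a * Poly_Mapping.lookup t b
      else 0 else 0)"
    by (subst poly_mapping_mult_expand)
      (auto simp: lookup_sum lookup_single when_def unique intro!: sum.cong)
  also have "\<dots> = Poly_Mapping.lookup s a * Poly_Mapping.lookup t b"
    using a(1) b(1) by simp
  also have "\<dots> \<noteq> 0"
    using a(1) b(1) by (simp add: in_keys_iff)
  finally show ?thesis
    by auto
qed

lemma laurent_prod_nonzero: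
  fixes s :: "'i \<Rightarrow> (int \<times> int) \<Rightarrow>\<^sub>0 'a::field"
  assumes "\<And>i. i \<in> I \<Longrightarrow> s i \<noteq> 0"
  shows "(\<Prod>i\<in>I. s i) \<noteq> 0"
  using assms
  by (induction I rule: infinite_finite_induct) (auto simp: laurent_mult_nonzero)

lemma sections_mono: "A \<subseteq> B \<Longrightarrow> sections A \<subseteq> sections B"
  by (auto simp: sections_def)

lemma sections_add: "s \<in> sections A \<Longrightarrow> t \<in> sections A \<Longrightarrow> s + t \<in> sections A"
  using keys_add[of s t] unfolding sections_def by blast

lemma sections_diff: "s \<in> sections A \<Longrightarrow> t \<in> sections A \<Longrightarrow> s - t \<in> sections A"
  using keys_diff[of s t] unfolding sections_def by blast

lemma sections_single: "lattice_point m \<in> A \<Longrightarrow> Poly_Mapping.single m c \<in> sections A"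
  by (auto simp: sections_def)

lemma sections_mult:
  assumes "s \<in> sections A" "t \<in> sections B"
  shows "s * t \<in> sections (A + B)"
proof -
  have "lattice_point k \<in> A + B" if k: "k \<in> Poly_Mapping.keys (s * t)" for k
  proof -
    obtain a b where "a \<in> Poly_Mapping.keys s" "b \<in> Poly_Mapping.keys t" "k = a + b"
      using k keys_mult[of s t] by blast
    then have "lattice_point a \<in> A" "lattice_point b \<in> B"
      "lattice_point k = lattice_point a + lattice_point b"
      using assms by (auto simp: sections_def lattice_point_def)
    then show ?thesis
      by auto
  qed
  then show ?thesis
    by (auto simp: sections_def)
qed

lemma sections_prod:
  assumes "finite I" "\<And>i. i \<in> I \<Longrightarrow> s i \<in> sections (A i)"
  shows "(\<Prod>i\<in>I. s i) \<in> sections (\<Sum>i\<in>I. A i)"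
  using assms
proof (induction I)
  case empty
  show ?case
    by (auto simp: sections_def lattice_point_def zero_prod_def)
qed (simp add: sections_mult)

section \<open>Sections are determined by their values on the torus\<close>

lemma fits_in_square_lattice_points:
  assumes "fits_in_square n P" "lattice_point a \<in> P" "lattice_point b \<in> P"
  shows "\<bar>fst a - fst b\<bar> < int n" "\<bar>snd a - snd b\<bar> < int n"
proof -
  obtain t where t: "(\<lambda>x. x + lattice_point t) ` P \<subseteq> square n"
    using assms by (auto simp: fits_in_square_def)
  have shift: "0 \<le> fst m + fst t \<and> fst m + fst t < int n \<and>
    0 \<le> snd m + snd t \<and> snd m + snd t < int n" if "lattice_point m \<in> P" for m
  proof -
    have "lattice_point m + lattice_point t \<in> square n"
      using t that by auto
    then have "0 \<le> real_of_int (fst m + fst t)" "real_of_int (fst m + fst t) \<le> real n - 1"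
      "0 \<le> real_of_int (snd m + snd t)" "real_of_int (snd m + snd t) \<le> real n - 1"
      by (auto simp: lattice_point_def square_def)
    then show ?thesis
      by linarith
  qed
  show "\<bar>fst a - fst b\<bar> < int n" "\<bar>snd a - snd b\<bar> < int n"
    using shift[OF assms(2)] shift[OF assms(3)] by linarith+
qed

text \<open>
  Fourier inversion on the torus. The usual factor \<open>1 / (q - 1)\<^sup>2\<close> is absent because
  \<open>q - 1\<close> is \<open>- 1\<close> in the field.
\<close>

lemma laurent_coefficient_from_torus_values:
  fixes s :: "(int \<times> int) \<Rightarrow>\<^sub>0 'a::{finite,field}"
  assumes \<xi>: "primitive_element (\<xi>::'a)" and fits: "fits_in_square (CARD('a) - 1) P"
    and s: "s \<in> sections P" and a: "lattice_point a \<in> P"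
  shows "(\<Sum>x\<in>-{0}. \<Sum>y\<in>-{0}. laurent_eval s (x, y) * x powi (- fst a) * y powi (- snd a))
    = Poly_Mapping.lookup s a"
proof -
  let ?U = "- {0::'a}" and ?K = "Poly_Mapping.keys s"
  have "(\<Sum>x\<in>?U. \<Sum>y\<in>?U. laurent_eval s (x, y) * x powi (- fst a) * y powi (- snd a)) =
    (\<Sum>x\<in>?U. \<Sum>y\<in>?U. \<Sum>m\<in>?K.
      Poly_Mapping.lookup s m * (x powi (fst m - fst a) * y powi (snd m - snd a)))"
    unfolding laurent_eval_def sum_distrib_right
    by (intro sum.cong refl) (simp add: power_int_diff power_int_minus field_simps)
  also have "\<dots> = (\<Sum>x\<in>?U. \<Sum>m\<in>?K. \<Sum>y\<in>?U.
      Poly_Mapping.lookup s m * (x powi (fst m - fst a) * y powi (snd m - snd a)))"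
    by (intro sum.cong refl, rule sum.swap)
  also have "\<dots> = (\<Sum>m\<in>?K. \<Sum>x\<in>?U. \<Sum>y\<in>?U.
      Poly_Mapping.lookup s m * (x powi (fst m - fst a) * y powi (snd m - snd a)))"
    by (rule sum.swap)
  also have "\<dots> = (\<Sum>m\<in>?K. Poly_Mapping.lookup s m *
      ((\<Sum>x\<in>?U. x powi (fst m - fst a)) * (\<Sum>y\<in>?U. y powi (snd m - snd a))))"
    by (intro sum.cong refl) (simp only: sum_product, simp only: sum_distrib_left)
  also have "\<dots> = (\<Sum>m\<in>?K. if m = a then Poly_Mapping.lookup s m else 0)"
  proof (intro sum.cong refl)
    fix m assume "m \<in> ?K"
    then have "lattice_point m \<in> P"
      using s by (auto simp: sections_def)
    then have "\<bar>fst m - fst a\<bar> < int CARD('a) - 1" "\<bar>snd m - snd a\<bar> < int CARD('a) - 1"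
      using fits_in_square_lattice_points[OF fits _ a] by (auto simp: of_nat_diff Suc_leI)
    then show "Poly_Mapping.lookup s m *
      ((\<Sum>x\<in>?U. x powi (fst m - fst a)) * (\<Sum>y\<in>?U. y powi (snd m - snd a))) =
      (if m = a then Poly_Mapping.lookup s m else 0)"
      by (simp add: sum_units_powi[OF \<xi>] prod_eq_iff)
  qed
  also have "\<dots> = Poly_Mapping.lookup s a"
    by (simp add: in_keys_iff)
  finally show ?thesis .
qed

lemma nonzero_section_nonvanishing:
  fixes s :: "(int \<times> int) \<Rightarrow>\<^sub>0 'a::{finite,field}"
  assumes \<xi>: "primitive_element (\<xi>::'a)" and fits: "fits_in_square (CARD('a) - 1) P"
    and s: "s \<in> sections P" "s \<noteq> 0"
  shows "\<exists>x y. x \<noteq> 0 \<and> y \<noteq> 0 \<and> laurent_eval s (x, y) \<noteq> 0"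
proof (rule ccontr)
  assume vanish: "\<not> ?thesis"
  obtain a where a: "a \<in> Poly_Mapping.keys s"
    using s(2) keys_eq_empty by blast
  then have "lattice_point a \<in> P"
    using s(1) by (auto simp: sections_def)
  then have "Poly_Mapping.lookup s a =
    (\<Sum>x\<in>-{0}. \<Sum>y\<in>-{0}. laurent_eval s (x, y) * x powi (- fst a) * y powi (- snd a))"
    by (rule laurent_coefficient_from_torus_values[OF \<xi> fits s(1), symmetric])
  also have "\<dots> = 0"
    by (intro sum.neutral ballI) (use vanish in auto)
  finally have "Poly_Mapping.lookup s a = 0" .
  with a show False
    by (simp add: in_keys_iff)
qed

section \<open>Words of the toric code\<close>

definition section_word ::
    "'a::{finite,field} \<Rightarrow> ((int \<times> int) \<Rightarrow>\<^sub>0 'a) \<Rightarrow> nat \<times> nat \<Rightarrow> 'a" where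
  "section_word \<xi> s =
     (\<lambda>(i, j). if (i, j) \<in> toric_index CARD('a) then laurent_eval s (\<xi> ^ i, \<xi> ^ j) else 0)"

lemma section_word_add: "section_word \<xi> (s + t) = section_word \<xi> s + section_word \<xi> t"
  by (auto simp: section_word_def laurent_eval_add fun_eq_iff)

lemma section_word_diff: "section_word \<xi> (s - t) = section_word \<xi> s - section_word \<xi> t"
  by (auto simp: section_word_def laurent_eval_diff fun_eq_iff)

lemma section_word_zero [simp]: "section_word \<xi> 0 = 0"
  by (auto simp: section_word_def fun_eq_iff)

lemma section_word_sum: "section_word \<xi> (\<Sum>i\<in>I. s i) = (\<Sum>i\<in>I. section_word \<xi> (s i))"
  by (induction I rule: infinite_finite_induct) (auto simp: section_word_add)

lemma section_word_single:
  "section_word \<xi> (Poly_Mapping.single m c) = (\<lambda>k. c * toric_word \<xi> m k)"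
  by (auto simp: section_word_def toric_word_def fun_eq_iff)

text \<open>
  Passing from the spanning words to sections turns statements about the code into
  statements about zeroes of Laurent polynomials.
\<close>

lemma toric_code_eq_section_words: "toric_code \<xi> Q = section_word \<xi> ` sections Q"
proof -
  interpret words: module "(\<lambda>c v k. c * v k) :: 'a \<Rightarrow> (nat \<times> nat \<Rightarrow> 'a) \<Rightarrow> _"
    by (rule module_words)
  show ?thesis
  proof (intro equalityI subsetI)
    fix w assume "w \<in> toric_code \<xi> Q"
    then have "w \<in> words.span (toric_word \<xi> ` {m. lattice_point m \<in> Q})"
      by (simp add: toric_code_def linear_span_def)
    then show "w \<in> section_word \<xi> ` sections Q"
    proof (induction rule: words.span_induct_alt)
      case base
      show ?case
        by (rule image_eqI[of _ _ 0]) (auto simp: sections_def)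
    next
      case (step c x y)
      then obtain m t where m: "lattice_point m \<in> Q" "x = toric_word \<xi> m"
        and t: "t \<in> sections Q" "y = section_word \<xi> t"
        by auto
      have "(\<lambda>k. c * x k) + y = section_word \<xi> (Poly_Mapping.single m c + t)"
        by (simp add: section_word_add section_word_single m t)
      moreover have "Poly_Mapping.single m c + t \<in> sections Q"
        by (intro sections_add sections_single m t)
      ultimately show ?case
        by blast
    qed
  next
    fix w assume "w \<in> section_word \<xi> ` sections Q"
    then obtain s where s: "s \<in> sections Q" "w = section_word \<xi> s"
      by auto
    have "w = section_word \<xi>
        (\<Sum>m\<in>Poly_Mapping.keys s. Poly_Mapping.single m (Poly_Mapping.lookup s m))"
      using s(2) by (simp only: poly_mapping_sum_single[symmetric])
    also have "\<dots> = (\<Sum>m\<in>Poly_Mapping.keys s.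
        (\<lambda>k. Poly_Mapping.lookup s m * toric_word \<xi> m k))"
      by (simp only: section_word_sum section_word_single)
    also have "\<dots> \<in> words.span (toric_word \<xi> ` {m. lattice_point m \<in> Q})"
      by (intro words.span_sum words.span_scale words.span_base)
        (use s in \<open>auto simp: sections_def\<close>)
    finally show "w \<in> toric_code \<xi> Q"
      by (simp add: toric_code_def linear_span_def)
  qed
qed

text \<open>
  The powers of \<open>\<xi>\<close> put the coordinates of a word in bijection with the points of the torus.
\<close>

lemma hamming_distance_plus_torus_zeros:
  fixes \<xi> :: "'a::{finite,field}"
  assumes \<xi>: "primitive_element \<xi>"
  shows "hamming_distance (toric_index CARD('a)) (section_word \<xi> s) (section_word \<xi> t)
    + card (torus_zeros (s - t)) = (CARD('a) - 1)\<^sup>2"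
proof -
  let ?I = "toric_index CARD('a)" and ?U = "- {0::'a}"
  let ?T = "{p \<in> ?U \<times> ?U. laurent_eval (s - t) p \<noteq> 0}"
  let ?f = "map_prod (\<lambda>i. \<xi> ^ i) (\<lambda>j. \<xi> ^ j)"
  have bij: "bij_betw ?f ?I (?U \<times> ?U)"
    unfolding toric_index_def
    by (intro bij_betw_map_prod primitive_element_bij_betw \<xi>)
  have differ: "section_word \<xi> s k \<noteq> section_word \<xi> t k \<longleftrightarrow> laurent_eval (s - t) (?f k) \<noteq> 0"
    if "k \<in> ?I" for k
    using that by (cases k) (auto simp: section_word_def laurent_eval_diff)
  have "bij_betw ?f {k \<in> ?I. section_word \<xi> s k \<noteq> section_word \<xi> t k} ?T"
  proof (rule bij_betw_subset[OF bij])
    have "{k \<in> ?I. section_word \<xi> s k \<noteq> section_word \<xi> t k}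
      = {k \<in> ?I. laurent_eval (s - t) (?f k) \<noteq> 0}"
      by (intro Collect_cong conj_cong refl differ)
    moreover have "?f ` {k \<in> ?I. laurent_eval (s - t) (?f k) \<noteq> 0}
      = {p \<in> ?f ` ?I. laurent_eval (s - t) p \<noteq> 0}"
      by (rule Compr_image_eq[symmetric])
    ultimately show "?f ` {k \<in> ?I. section_word \<xi> s k \<noteq> section_word \<xi> t k} = ?T"
      by (simp only: bij_betw_imp_surj_on[OF bij])
  qed auto
  then have "hamming_distance ?I (section_word \<xi> s) (section_word \<xi> t) = card ?T"
    unfolding hamming_distance_def by (rule bij_betw_same_card)
  moreover have "card ?T + card (torus_zeros (s - t)) = card (?T \<union> torus_zeros (s - t))"
    by (rule card_Un_disjoint[symmetric]) (auto simp: torus_zeros_def)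
  moreover have "?T \<union> torus_zeros (s - t) = ?U \<times> ?U"
    by (auto simp: torus_zeros_def)
  ultimately show ?thesis
    by (simp add: card_cartesian_product card_units power2_eq_square)
qed

lemma finite_toric_distances:
  "finite {hamming_distance (toric_index n) u v | u v. u \<in> C \<and> v \<in> C \<and> u \<noteq> v}"
proof (rule finite_subset)
  have "finite (toric_index n)"
    by (simp add: toric_index_def)
  then show "{hamming_distance (toric_index n) u v | u v. u \<in> C \<and> v \<in> C \<and> u \<noteq> v}
    \<subseteq> {..card (toric_index n)}"
    by (auto simp: hamming_distance_def intro!: card_mono)
qed simp

text \<open>
  The word of \<open>s\<close> is compared with the zero word. The fitting condition ensures that the two are
  distinct.
\<close>

lemma toric_distance_le:
  fixes \<xi> :: "'a::{finite,field}" and s :: "(int \<times> int) \<Rightarrow>\<^sub>0 'a"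
  assumes \<xi>: "primitive_element \<xi>" and fits: "fits_in_square (CARD('a) - 1) P"
    and s: "s \<in> sections P" "s \<noteq> 0"
  shows "toric_distance \<xi> P + card (torus_zeros s) \<le> (CARD('a) - 1)\<^sup>2"
proof -
  let ?I = "toric_index CARD('a)"
  obtain x y where xy: "x \<noteq> 0" "y \<noteq> 0" "laurent_eval s (x, y) \<noteq> 0"
    using nonzero_section_nonvanishing[OF \<xi> fits s] by blast
  have "x \<in> (\<lambda>i. \<xi> ^ i) ` {0..CARD('a) - 2}" "y \<in> (\<lambda>i. \<xi> ^ i) ` {0..CARD('a) - 2}"
    using xy(1,2) by (simp_all add: bij_betw_imp_surj_on[OF primitive_element_bij_betw[OF \<xi>]])
  then obtain i j where
    "i \<in> {0..CARD('a) - 2}" "x = \<xi> ^ i" "j \<in> {0..CARD('a) - 2}" "y = \<xi> ^ j"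
    by blast
  then have "section_word \<xi> s (i, j) \<noteq> 0"
    using xy by (auto simp: section_word_def toric_index_def)
  then have "section_word \<xi> s \<noteq> section_word \<xi> 0"
    by auto
  moreover have "section_word \<xi> s \<in> toric_code \<xi> P" "section_word \<xi> 0 \<in> toric_code \<xi> P"
    unfolding toric_code_eq_section_words using s
    by (auto simp: sections_def simp del: section_word_zero)
  ultimately have "toric_distance \<xi> P \<le> hamming_distance ?I (section_word \<xi> s) (section_word \<xi> 0)"
    unfolding toric_distance_def minimum_distance_def
    by (intro Min_le finite_toric_distances) blast
  with hamming_distance_plus_torus_zeros[OF \<xi>, of s 0] show ?thesis
    by simp
qed

text \<open>
  The minimum distance is attained by two words of the code, whose sections have a nonzero difference. The
  lattice point \<open>a\<close> provides a nonzero word, so that two distinct words exist at all.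
\<close>

lemma toric_distance_ge:
  fixes \<xi> :: "'a::{finite,field}"
  assumes \<xi>: "primitive_element \<xi>" and a: "lattice_point a \<in> Q"
    and zeros: "\<And>s::(int \<times> int) \<Rightarrow>\<^sub>0 'a. s \<in> sections Q \<Longrightarrow> s \<noteq> 0 \<Longrightarrow> card (torus_zeros s) \<le> M"
  shows "(CARD('a) - 1)\<^sup>2 \<le> toric_distance \<xi> Q + M"
proof -
  let ?D = "{hamming_distance (toric_index CARD('a)) u v | u v.
    u \<in> toric_code \<xi> Q \<and> v \<in> toric_code \<xi> Q \<and> u \<noteq> v}"
  let ?x = "Poly_Mapping.single a (1::'a)"
  have "?x \<in> sections Q" "0 \<in> sections Q"
    using a by (auto simp: sections_def)
  moreover have "section_word \<xi> ?x (0, 0) \<noteq> section_word \<xi> 0 (0, 0)"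
    by (simp add: section_word_def toric_index_def)
  then have "section_word \<xi> ?x \<noteq> section_word \<xi> 0"
    by metis
  ultimately have "?D \<noteq> {}"
    unfolding toric_code_eq_section_words by blast
  then have "toric_distance \<xi> Q \<in> ?D"
    unfolding toric_distance_def minimum_distance_def by (rule Min_in[OF finite_toric_distances])
  then obtain s t where st: "s \<in> sections Q" "t \<in> sections Q"
    "section_word \<xi> s \<noteq> section_word \<xi> t"
    "toric_distance \<xi> Q =
      hamming_distance (toric_index CARD('a)) (section_word \<xi> s) (section_word \<xi> t)"
    unfolding toric_code_eq_section_words by auto
  then have "card (torus_zeros (s - t)) \<le> M"
    by (intro zeros sections_diff) auto
  with hamming_distance_plus_torus_zeros[OF \<xi>, of s t] st(4) show ?thesis
    by simp
qed

section \<open>The bound for Minkowski sums\<close>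

theorem proposition2p3:
  fixes \<xi> :: "'a::{finite,field}"
    and q l :: nat
    and P :: "(real \<times> real) set"
    and Q :: "nat \<Rightarrow> (real \<times> real) set"
    and m :: "nat \<Rightarrow> nat"
  assumes q: "q = CARD('a)"
    and \<xi>: "primitive_element \<xi>"
    and l: "l \<ge> 1"
    and P: "lattice_polygon P" "fits_in_square (q - 1) P"
    and Q: "\<And>i. i \<in> {1..l} \<Longrightarrow> lattice_polygon (Q i)"
    and Minkowski_sum: "(\<Sum>i=1..l. Q i) \<subseteq> P"
    and m: "\<And>i. i \<in> {1..l} \<Longrightarrow>
      m i = Max {card (torus_zeros s) | s :: (int \<times> int) \<Rightarrow>\<^sub>0 'a. s \<in> sections (Q i) \<and> s \<noteq> 0}"
    and disjoint_zeros: "\<exists>s :: nat \<Rightarrow> (int \<times> int) \<Rightarrow>\<^sub>0 'a.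
      (\<forall>i\<in>{1..l}. s i \<in> sections (Q i) \<and> s i \<noteq> 0 \<and> card (torus_zeros (s i)) = m i) \<and>
      disjoint_family_on (\<lambda>i. torus_zeros (s i)) {1..l}"
  shows "int (toric_distance \<xi> P)
    \<le> (\<Sum>i=1..l. int (toric_distance \<xi> (Q i))) - (int l - 1) * (int q - 1)\<^sup>2"
proof -
  let ?N = "(CARD('a) - 1)\<^sup>2" and ?I = "{1..l}"
  obtain s :: "nat \<Rightarrow> (int \<times> int) \<Rightarrow>\<^sub>0 'a"
    where s: "\<And>i. i \<in> ?I \<Longrightarrow> s i \<in> sections (Q i)" "\<And>i. i \<in> ?I \<Longrightarrow> s i \<noteq> 0"
      "\<And>i. i \<in> ?I \<Longrightarrow> card (torus_zeros (s i)) = m i"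
      and disj: "disjoint_family_on (\<lambda>i. torus_zeros (s i)) ?I"
    using disjoint_zeros by blast
  let ?s = "\<Prod>i\<in>?I. s i"
  have summand: "int ?N - int (m i) \<le> int (toric_distance \<xi> (Q i))" if i: "i \<in> ?I" for i
  proof -
    obtain a where "a \<in> Poly_Mapping.keys (s i)"
      using s(2)[OF i] keys_eq_empty by blast
    then have "lattice_point a \<in> Q i"
      using s(1)[OF i] by (auto simp: sections_def)
    moreover have "card (torus_zeros t) \<le> m i" if "t \<in> sections (Q i)" "t \<noteq> 0"
      for t :: "(int \<times> int) \<Rightarrow>\<^sub>0 'a"
      unfolding m[OF i]
    proof (rule Max_ge)
      show "finite {card (torus_zeros s) | s :: (int \<times> int) \<Rightarrow>\<^sub>0 'a. s \<in> sections (Q i) \<and> s \<noteq> 0}"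
        by (rule finite_subset[of _ "{..CARD('a \<times> 'a)}"]) (auto simp del: card_prod intro!: card_mono)
    qed (use that in blast)
    ultimately have "?N \<le> toric_distance \<xi> (Q i) + m i"
      by (rule toric_distance_ge[OF \<xi>])
    then show ?thesis
      by linarith
  qed
  have "?s \<in> sections (\<Sum>i\<in>?I. Q i)"
    by (rule sections_prod) (use s in auto)
  then have "?s \<in> sections P"
    using sections_mono[OF Minkowski_sum] by blast
  moreover have "?s \<noteq> 0"
    by (rule laurent_prod_nonzero) (use s in auto)
  ultimately have "toric_distance \<xi> P + card (torus_zeros ?s) \<le> ?N"
    using toric_distance_le[OF \<xi>] P(2) q by blast
  moreover have "card (torus_zeros ?s) = (\<Sum>i\<in>?I. card (torus_zeros (s i)))"
    unfolding torus_zeros_prod[OF finite_atLeastAtMost]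
    by (rule card_UN_disjoint) (use disj in \<open>auto simp: disjoint_family_on_def\<close>)
  moreover have "\<dots> = (\<Sum>i\<in>?I. m i)"
    using s(3) by simp
  ultimately have "int (toric_distance \<xi> P) \<le> int ?N - (\<Sum>i\<in>?I. int (m i))"
    unfolding of_nat_sum[symmetric] by linarith
  also have "\<dots> = (\<Sum>i\<in>?I. int ?N - int (m i)) - (int l - 1) * int ?N"
    by (simp add: sum_subtractf algebra_simps)
  also have "\<dots> \<le> (\<Sum>i\<in>?I. int (toric_distance \<xi> (Q i))) - (int l - 1) * int ?N"
    by (intro diff_right_mono sum_mono summand)
  also have "int ?N = (int q - 1)\<^sup>2"
    by (simp add: q of_nat_diff Suc_leI)
  finally show ?thesis .
qed

end
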